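(* There is no monad structure on the functor $\mathsf{P}\mathsf{D}:\mathbf{Set}\to\mathbf{Set}$; that is, there exist no natural transformations $\eta:\mathsf{Id}\to\mathsf{P}\mathsf{D}$ and $\mu:\mathsf{P}\mathsf{D}\mathsf{P}\mathsf{D}\to\mathsf{P}\mathsf{D}$ satisfying the monad laws.
   Context: $\mathsf{P}:\mathbf{Set}\to\mathbf{Set}$ is the covariant powerset functor (direct image on maps). $\mathsf{D}:\mathbf{Set}\to\mathbf{Set}$ is the finitely supported distribution functor: $\mathsf{D}X$ is the set of finitely supported $\mu:X\to[0,1]$ with $\sum_x\mu(x)=1$, and $\mathsf{D}f(\mu)(y)=\sum_{x\in f^{-1}(\{y\})}\mu(x)$. The monad laws are $\mu\circ\eta_{\mathsf{P}\mathsf{D}}=\mathrm{id}=\mu\circ\mathsf{P}\mathsf{D}\eta$ and $\mu\circ\mu_{\mathsf{P}\mathsf{D}}=\mu\circ\mathsf{P}\mathsf{D}\mu$. *)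

theory Defs
  imports "HOL-Probability.Probability_Mass_Function" "HOL-Library.FuncSet"
begin

text \<open>
  A HOL formula cannot quantify over families indexed by all types. The category of sets is therefore
  taken to be that of a set-theoretic universe: a type whose elements are the sets of a (second-order)
  model of ZFC. Choice for the model is inherited from HOL, and pairing and the empty set follow from
  infinity, separation and replacement. HOL cannot prove that such a type exists.
\<close>

class zfc_universe =
  fixes elts :: "'a \<Rightarrow> 'a set"
  assumes extensionality: "elts x = elts y \<Longrightarrow> x = y"
    and foundation: "wf {(x, y). x \<in> elts y}"
    and separation: "\<exists>y. elts y = elts x \<inter> A"
    and union: "\<exists>y. elts y = (\<Union>z\<in>elts x. elts z)"
    and powerset: "\<exists>y. elts y = {z. elts z \<subseteq> elts x}"
    and replacement: "\<exists>y. elts y = f ` elts x"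
    and infinity: "\<exists>x. infinite (elts x)"

definition small :: "'v::zfc_universe set \<Rightarrow> bool" where
  "small A \<longleftrightarrow> (\<exists>x. elts x = A)"

text \<open>Unspecified on classes that are not small; it is only applied to small ones.\<close>

definition vset :: "'v::zfc_universe set \<Rightarrow> 'v" where
  "vset A = (THE x. elts x = A)"

lemma elts_vset: "small A \<Longrightarrow> elts (vset A) = A"
  unfolding small_def vset_def by (rule theI') (blast intro: extensionality)

lemma vset_elts [simp]: "vset (elts x) = x"
  by (rule extensionality, rule elts_vset) (auto simp: small_def)

lemma small_elts [simp]: "small (elts x)"
  by (auto simp: small_def)

lemma small_subset:
  assumes "small A" and "B \<subseteq> A"
  shows "small B"
proof -
  obtain x where "elts x = A" using assms(1) by (auto simp: small_def)
  then obtain y where "elts y = A \<inter> B" using separation[of x B] by auto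
  then show ?thesis using assms(2) by (auto simp: small_def inf_absorb2)
qed

lemma small_image: "small A \<Longrightarrow> small (f ` A)" for f :: "'v::zfc_universe \<Rightarrow> 'v"
  unfolding small_def using replacement by auto

lemma small_Union:
  fixes B :: "'v::zfc_universe \<Rightarrow> 'v set"
  assumes "small A" and "\<And>x. x \<in> A \<Longrightarrow> small (B x)"
  shows "small (\<Union>x\<in>A. B x)"
proof -
  from small_image[OF assms(1), of "\<lambda>x. vset (B x)"]
  obtain w where w: "elts w = (\<lambda>x. vset (B x)) ` A" by (auto simp: small_def)
  obtain u where "elts u = (\<Union>z\<in>elts w. elts z)" using union by blast
  also have "\<dots> = (\<Union>x\<in>A. B x)" using assms(2) by (simp add: w elts_vset)
  finally show ?thesis by (auto simp: small_def)
qed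

lemma small_Pow: "small A \<Longrightarrow> small {z. elts z \<subseteq> A}"
  unfolding small_def using powerset by auto

lemma small_countable:
  fixes A :: "'v::zfc_universe set"
  assumes "countable A"
  shows "small A"
proof -
  obtain x :: 'v where x: "infinite (elts x)" using infinity by blast
  then obtain f :: "nat \<Rightarrow> 'v" where f: "inj f" "range f \<subseteq> elts x"
    using infinite_countable_subset by blast
  have sf: "small (range f)" using f(2) small_subset small_elts by blast
  show ?thesis
  proof (cases "A = {}")
    case True
    then show ?thesis using sf small_subset by blast
  next
    case False
    have "(from_nat_into A \<circ> inv f) ` range f = A"
      using False assms f(1) by (simp add: image_image range_from_nat_into)
    then show ?thesis using small_image[OF sf] by metis
  qed
qed

text \<open>
  Sets of the universe representing numbers and distributions: Zermelo numerals, Kuratowski pairs,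
  Dedekind cuts, and a distribution as the graph of its restriction to its support. A finitely
  supported \<open>\<mu> : X \<rightarrow> [0, 1]\<close> of total mass 1 is a \<open>pmf\<close> on the universe with finite support
  contained in \<open>elts X\<close>, and its direct image is given by \<open>map_pmf\<close>.
\<close>

primrec vnat :: "nat \<Rightarrow> 'v::zfc_universe" where
  "vnat 0 = vset {}"
| "vnat (Suc n) = vset {vnat n}"

definition vpair :: "'v::zfc_universe \<Rightarrow> 'v \<Rightarrow> 'v" where
  "vpair x y = vset {vset {x}, vset {x, y}}"

definition vreal :: "real \<Rightarrow> 'v::zfc_universe" where
  "vreal r = vset {vnat (to_nat q) |q :: rat. of_rat q < r}"

definition vdist :: "'v::zfc_universe pmf \<Rightarrow> 'v" where
  "vdist p = vset ((\<lambda>x. vpair x (vreal (pmf p x))) ` set_pmf p)"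

lemma vset_eq_iff: "countable A \<Longrightarrow> countable B \<Longrightarrow> vset A = vset B \<longleftrightarrow> A = B"
  by (metis elts_vset small_countable)

lemma inj_vnat: "inj (vnat :: nat \<Rightarrow> 'v::zfc_universe)"
proof (rule injI)
  fix m n
  show "(vnat m :: 'v) = vnat n \<Longrightarrow> m = n"
  proof (induction m arbitrary: n)
    case 0
    then show ?case by (cases n) (auto simp: vset_eq_iff)
  next
    case (Suc m)
    then show ?case by (cases n) (auto simp: vset_eq_iff)
  qed
qed

lemma vpair_eq_iff: "vpair a b = vpair c d \<longleftrightarrow> a = c \<and> b = d"
  by (auto simp: vpair_def vset_eq_iff doubleton_eq_iff)

lemma elts_vreal: "elts (vreal r) = {vnat (to_nat q) |q :: rat. of_rat q < r}"
  unfolding vreal_def by (rule elts_vset, rule small_countable) (simp add: setcompr_eq_image)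

lemma vnat_mem_vreal: "vnat (to_nat q) \<in> elts (vreal r) \<longleftrightarrow> of_rat q < r" for q :: rat
  by (auto simp: elts_vreal inj_eq[OF inj_vnat])

lemma inj_vreal: "inj (vreal :: real \<Rightarrow> 'v::zfc_universe)"
proof (rule injI)
  fix r s :: real
  assume eq: "(vreal r :: 'v) = vreal s"
  have *: "of_rat q < r \<longleftrightarrow> of_rat q < s" for q
    using vnat_mem_vreal[of q r, where 'a = 'v] vnat_mem_vreal[of q s, where 'a = 'v]
    by (simp only: eq)
  show "r = s"
  proof (rule ccontr)
    assume "r \<noteq> s"
    then consider "r < s" | "s < r" by linarith
    then show False
    proof cases
      case 1
      then show False using of_rat_dense[of r s] * by (meson less_asym)
    next
      case 2
      then show False using of_rat_dense[of s r] * by (meson less_asym)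
    qed
  qed
qed

lemma elts_vdist: "elts (vdist p) = (\<lambda>x. vpair x (vreal (pmf p x))) ` set_pmf p"
  unfolding vdist_def by (rule elts_vset, rule small_countable) simp

lemma inj_vdist: "inj (vdist :: 'v::zfc_universe pmf \<Rightarrow> 'v)"
proof (rule injI)
  fix p q :: "'v pmf"
  assume "vdist p = vdist q"
  then have eq: "(\<lambda>x. vpair x (vreal (pmf p x))) ` set_pmf p
      = (\<lambda>x. vpair x (vreal (pmf q x))) ` set_pmf q"
    by (metis elts_vdist)
  have "x \<in> set_pmf q \<and> pmf p x = pmf q x" if "x \<in> set_pmf p" for x
  proof -
    have "vpair x (vreal (pmf p x)) \<in> (\<lambda>x. vpair x (vreal (pmf q x))) ` set_pmf q"
      using that eq by blast
    then show ?thesis by (auto simp: vpair_eq_iff inj_eq[OF inj_vreal])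
  qed
  moreover have "x \<in> set_pmf p \<and> pmf p x = pmf q x" if "x \<in> set_pmf q" for x
  proof -
    have "vpair x (vreal (pmf q x)) \<in> (\<lambda>x. vpair x (vreal (pmf p x))) ` set_pmf p"
      using that eq by blast
    then show ?thesis by (auto simp: vpair_eq_iff inj_eq[OF inj_vreal])
  qed
  ultimately show "p = q" by (intro pmf_eqI) (metis set_pmf_iff)
qed

lemma small_vdist: "small A \<Longrightarrow> small (vdist ` {p. finite (set_pmf p) \<and> set_pmf p \<subseteq> A})"
proof -
  assume A: "small A"
  have "small (range vnat)" by (rule small_countable) simp
  then have "small (range vreal)"
    by (rule small_subset[OF small_Pow]) (auto simp: elts_vreal)
  then have "small (\<Union>x\<in>A. vpair x ` range vreal)"
    by (intro small_Union A small_image)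
  then show ?thesis
    by (rule small_subset[OF small_Pow]) (fastforce simp: elts_vdist)
qed

text \<open>
  Functors on the category of sets: objects are the elements of the universe, and a morphism from
  \<open>X\<close> to \<open>Y\<close> is a function \<open>f \<in> elts X \<rightarrow> elts Y\<close>, its values outside \<open>elts X\<close> being irrelevant.
\<close>

record 'v endofunctor =
  ob :: "'v \<Rightarrow> 'v"
  ar :: "('v \<Rightarrow> 'v) \<Rightarrow> 'v \<Rightarrow> 'v"

definition is_functor :: "'v::zfc_universe endofunctor \<Rightarrow> bool" where
  "is_functor F \<longleftrightarrow>
    (\<forall>X Y. \<forall>f \<in> elts X \<rightarrow> elts Y. ar F f \<in> elts (ob F X) \<rightarrow> elts (ob F Y)) \<and>
    (\<forall>X f g. (\<forall>x\<in>elts X. f x = g x) \<longrightarrow> (\<forall>u\<in>elts (ob F X). ar F f u = ar F g u)) \<and>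
    (\<forall>X. \<forall>u\<in>elts (ob F X). ar F (\<lambda>x. x) u = u) \<and>
    (\<forall>X Y Z. \<forall>f \<in> elts X \<rightarrow> elts Y. \<forall>g \<in> elts Y \<rightarrow> elts Z.
      \<forall>u\<in>elts (ob F X). ar F (g \<circ> f) u = ar F g (ar F f u))"

definition Id_F :: "'v endofunctor" where
  "Id_F = \<lparr>ob = \<lambda>X. X, ar = \<lambda>f. f\<rparr>"

definition comp_F :: "'v endofunctor \<Rightarrow> 'v endofunctor \<Rightarrow> 'v endofunctor"  (infixr "\<odot>" 70) where
  "G \<odot> F = \<lparr>ob = \<lambda>X. ob G (ob F X), ar = \<lambda>f. ar G (ar F f)\<rparr>"

definition P_F :: "'v::zfc_universe endofunctor" where
  "P_F = \<lparr>ob = \<lambda>X. vset {A. elts A \<subseteq> elts X}, ar = \<lambda>f A. vset (f ` elts A)\<rparr>"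

definition D_F :: "'v::zfc_universe endofunctor" where
  "D_F = \<lparr>ob = \<lambda>X. vset (vdist ` {p. finite (set_pmf p) \<and> set_pmf p \<subseteq> elts X}),
          ar = \<lambda>f u. vdist (map_pmf f (inv vdist u))\<rparr>"

definition natural_transformation ::
  "'v::zfc_universe endofunctor \<Rightarrow> 'v endofunctor \<Rightarrow> ('v \<Rightarrow> 'v \<Rightarrow> 'v) \<Rightarrow> bool" where
  "natural_transformation F G \<tau> \<longleftrightarrow>
    (\<forall>X. \<tau> X \<in> elts (ob F X) \<rightarrow> elts (ob G X)) \<and>
    (\<forall>X Y. \<forall>f \<in> elts X \<rightarrow> elts Y. \<forall>u\<in>elts (ob F X). \<tau> Y (ar F f u) = ar G f (\<tau> X u))"

definition is_monad ::
  "'v::zfc_universe endofunctor \<Rightarrow> ('v \<Rightarrow> 'v \<Rightarrow> 'v) \<Rightarrow> ('v \<Rightarrow> 'v \<Rightarrow> 'v) \<Rightarrow> bool" where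
  "is_monad T \<eta> \<mu> \<longleftrightarrow>
    natural_transformation Id_F T \<eta> \<and>
    natural_transformation (T \<odot> T) T \<mu> \<and>
    (\<forall>X. \<forall>u\<in>elts (ob T X). \<mu> X (\<eta> (ob T X) u) = u) \<and>
    (\<forall>X. \<forall>u\<in>elts (ob T X). \<mu> X (ar T (\<eta> X) u) = u) \<and>
    (\<forall>X. \<forall>u\<in>elts (ob (T \<odot> T \<odot> T) X). \<mu> X (\<mu> (ob T X) u) = \<mu> X (ar T (\<mu> X) u))"

lemma elts_P: "elts (ob P_F X) = {A. elts A \<subseteq> elts X}"
  by (simp add: P_F_def elts_vset small_Pow)

lemma elts_P_ar: "elts (ar P_F f A) = f ` elts A"
  by (simp add: P_F_def elts_vset small_image)

lemma elts_D: "elts (ob D_F X) = vdist ` {p. finite (set_pmf p) \<and> set_pmf p \<subseteq> elts X}"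
  by (simp add: D_F_def elts_vset small_vdist)

lemma D_ar: "ar D_F f (vdist p) = vdist (map_pmf f p)"
  by (simp add: D_F_def inj_vdist)

lemma is_functor_P: "is_functor (P_F :: 'v::zfc_universe endofunctor)"
  unfolding is_functor_def
proof (intro conjI allI ballI impI)
  fix X :: 'v and f g :: "'v \<Rightarrow> 'v" and u assume "\<forall>x\<in>elts X. f x = g x" "u \<in> elts (ob P_F X)"
  then show "ar P_F f u = ar P_F g u"
    by (intro extensionality) (auto simp: elts_P elts_P_ar subset_iff)
next
  fix X u :: 'v
  show "ar P_F (\<lambda>x. x) u = u" by (rule extensionality) (simp add: elts_P_ar)
next
  fix f g :: "'v \<Rightarrow> 'v" and u :: 'v
  show "ar P_F (g \<circ> f) u = ar P_F g (ar P_F f u)"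
    by (rule extensionality) (simp add: elts_P_ar image_comp)
qed (auto simp: elts_P elts_P_ar Pi_iff subset_iff)

lemma is_functor_D: "is_functor (D_F :: 'v::zfc_universe endofunctor)"
  unfolding is_functor_def
proof (intro conjI allI ballI impI)
  fix X :: 'v and f g :: "'v \<Rightarrow> 'v" and u assume "\<forall>x\<in>elts X. f x = g x" "u \<in> elts (ob D_F X)"
  then show "ar D_F f u = ar D_F g u"
    by (auto simp: elts_D D_ar subset_iff intro!: arg_cong[of _ _ vdist] map_pmf_cong)
next
  fix X Y :: 'v and f :: "'v \<Rightarrow> 'v" assume "f \<in> elts X \<rightarrow> elts Y"
  then show "ar D_F f \<in> elts (ob D_F X) \<rightarrow> elts (ob D_F Y)"
    by (fastforce simp: elts_D D_ar)
qed (auto simp: elts_D D_ar map_pmf_comp comp_def)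

lemma is_functorD:
  assumes "is_functor F"
  shows is_functor_hom: "f \<in> elts X \<rightarrow> elts Y \<Longrightarrow> ar F f \<in> elts (ob F X) \<rightarrow> elts (ob F Y)"
    and is_functor_cong:
      "(\<And>x. x \<in> elts X \<Longrightarrow> f x = g x) \<Longrightarrow> u \<in> elts (ob F X) \<Longrightarrow> ar F f u = ar F g u"
    and is_functor_id: "u \<in> elts (ob F X) \<Longrightarrow> ar F (\<lambda>x. x) u = u"
    and is_functor_o: "f \<in> elts X \<rightarrow> elts Y \<Longrightarrow> g \<in> elts Y \<rightarrow> elts Z \<Longrightarrow> u \<in> elts (ob F X) \<Longrightarrow>
      ar F (g \<circ> f) u = ar F g (ar F f u)"
  using assms unfolding is_functor_def by (blast, presburger, blast, blast)

lemma is_functor_comp: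
  fixes F G :: "'v::zfc_universe endofunctor"
  assumes F: "is_functor F" and G: "is_functor G"
  shows "is_functor (G \<odot> F)"
  unfolding is_functor_def comp_F_def endofunctor.simps
proof (intro conjI allI ballI impI)
  fix X Y :: 'v and f :: "'v \<Rightarrow> 'v" assume "f \<in> elts X \<rightarrow> elts Y"
  then show "ar G (ar F f) \<in> elts (ob G (ob F X)) \<rightarrow> elts (ob G (ob F Y))"
    by (intro is_functor_hom F G)
next
  fix X u :: 'v and f g :: "'v \<Rightarrow> 'v"
  assume "\<forall>x\<in>elts X. f x = g x" "u \<in> elts (ob G (ob F X))"
  then show "ar G (ar F f) u = ar G (ar F g) u"
    by (intro is_functor_cong[OF G, of "ob F X"] is_functor_cong[OF F, of X]) auto
next
  fix X u :: 'v assume u: "u \<in> elts (ob G (ob F X))"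
  have "ar G (ar F (\<lambda>x. x)) u = ar G (\<lambda>x. x) u"
    by (rule is_functor_cong[OF G is_functor_id[OF F] u])
  then show "ar G (ar F (\<lambda>x. x)) u = u" using is_functor_id[OF G u] by simp
next
  fix X Y Z u :: 'v and f g :: "'v \<Rightarrow> 'v"
  assume f: "f \<in> elts X \<rightarrow> elts Y" and g: "g \<in> elts Y \<rightarrow> elts Z"
    and u: "u \<in> elts (ob G (ob F X))"
  have "ar G (ar F (g \<circ> f)) u = ar G (ar F g \<circ> ar F f) u"
    by (rule is_functor_cong[OF G _ u]) (simp add: is_functor_o[OF F f g])
  also have "\<dots> = ar G (ar F g) (ar G (ar F f) u)"
    by (rule is_functor_o[OF G is_functor_hom[OF F f] is_functor_hom[OF F g] u])
  finally show "ar G (ar F (g \<circ> f)) u = ar G (ar F g) (ar G (ar F f) u)" .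
qed

end

theory Submission imports Defs begin

text \<open>
  Naturality and the right unit law force the unit to be \<open>x \<mapsto> {\<delta>\<^sub>x}\<close>. On four distinct points
  consider the image \<open>W\<close> under the multiplication of
  \<open>{1/2 {\<delta>\<^sub>a, \<delta>\<^sub>b} + 1/2 {\<delta>\<^sub>c, \<delta>\<^sub>d}}\<close>.
  Identifying \<open>a\<close> with \<open>c\<close> and \<open>b\<close> with \<open>d\<close> turns the mixture into a Dirac distribution, so by
  naturality and the left unit law \<open>W\<close> is nonempty and each of its elements is concentrated on
  \<open>{a, c}\<close> or on \<open>{b, d}\<close>. Identifying \<open>a\<close> with \<open>d\<close> and \<open>b\<close> with \<open>c\<close> shows in the same way that
  each element is concentrated on \<open>{a, d}\<close> or on \<open>{b, c}\<close>, hence at a single point. But identifying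
  \<open>a\<close> with \<open>b\<close> and \<open>c\<close> with \<open>d\<close>, the right unit law shows that each element of \<open>W\<close> gives mass
  \<open>1/2\<close> to both \<open>{a, b}\<close> and \<open>{c, d}\<close>. Associativity plays no role.
\<close>

abbreviation PD :: "'v::zfc_universe endofunctor" where
  "PD \<equiv> P_F \<odot> D_F"

text \<open>As the image of a coin flip, the mixture also makes sense for equal points, where it
  collapses to a Dirac distribution.\<close>

definition fair_mix :: "'a \<Rightarrow> 'a \<Rightarrow> 'a pmf" where
  "fair_mix x y = map_pmf (\<lambda>h. if h then x else y) (bernoulli_pmf (1/2))"

lemma set_fair_mix [simp]: "set_pmf (fair_mix x y) = {x, y}"
  by (auto simp: fair_mix_def)

lemma fair_mix_same [simp]: "fair_mix x x = return_pmf x"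
  by (simp add: fair_mix_def)

lemma map_fair_mix [simp]: "map_pmf f (fair_mix x y) = fair_mix (f x) (f y)"
  by (simp add: fair_mix_def map_pmf_comp if_distrib)

definition vdists :: "'v::zfc_universe pmf set \<Rightarrow> 'v" where
  "vdists Q = vset (vdist ` Q)"

lemma elts_vdists: "countable Q \<Longrightarrow> elts (vdists Q) = vdist ` Q"
  unfolding vdists_def by (intro elts_vset small_countable countable_image)

lemma vdists_eq_iff: "countable Q \<Longrightarrow> countable R \<Longrightarrow> vdists Q = vdists R \<longleftrightarrow> Q = R"
  by (metis elts_vdists inj_image_eq_iff inj_vdist)

lemma elts_PD: "u \<in> elts (ob PD X) \<longleftrightarrow> elts u \<subseteq> vdist ` {p. finite (set_pmf p) \<and> set_pmf p \<subseteq> elts X}"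
  by (simp add: comp_F_def elts_P elts_D)

lemma elts_PD_ar: "elts (ar PD f u) = ar D_F f ` elts u"
  by (simp add: comp_F_def elts_P_ar)

lemma vdists_in_PD:
  "countable Q \<Longrightarrow> (\<And>p. p \<in> Q \<Longrightarrow> finite (set_pmf p) \<and> set_pmf p \<subseteq> elts X) \<Longrightarrow>
    vdists Q \<in> elts (ob PD X)"
  by (auto simp: elts_PD elts_vdists)

lemma PD_ar_vdists: "countable Q \<Longrightarrow> ar PD f (vdists Q) = vdists (map_pmf f ` Q)"
  by (rule extensionality) (simp add: elts_PD_ar elts_vdists image_image D_ar)

lemma PD_hom: "f \<in> elts X \<rightarrow> elts Y \<Longrightarrow> ar PD f \<in> elts (ob PD X) \<rightarrow> elts (ob PD Y)"
  by (intro is_functor_hom is_functor_comp is_functor_P is_functor_D)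

locale PD_monad =
  fixes \<eta> \<mu> :: "'v::zfc_universe \<Rightarrow> 'v \<Rightarrow> 'v"
  assumes monad: "is_monad PD \<eta> \<mu>"
begin

lemma unit_closed: "x \<in> elts X \<Longrightarrow> \<eta> X x \<in> elts (ob PD X)"
  using monad by (auto simp: is_monad_def natural_transformation_def Id_F_def)

lemma unit_natural:
  "f \<in> elts X \<rightarrow> elts Y \<Longrightarrow> x \<in> elts X \<Longrightarrow> \<eta> Y (f x) = ar PD f (\<eta> X x)"
  using monad by (auto simp: is_monad_def natural_transformation_def Id_F_def)

lemma mult_closed: "u \<in> elts (ob PD (ob PD X)) \<Longrightarrow> \<mu> X u \<in> elts (ob PD X)"
  using monad by (auto simp: is_monad_def natural_transformation_def comp_F_def[of PD])

lemma mult_natural: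
  "f \<in> elts X \<rightarrow> elts Y \<Longrightarrow> u \<in> elts (ob PD (ob PD X)) \<Longrightarrow>
    \<mu> Y (ar PD (ar PD f) u) = ar PD f (\<mu> X u)"
  using monad by (auto simp: is_monad_def natural_transformation_def comp_F_def[of PD])

lemma left_unit: "u \<in> elts (ob PD X) \<Longrightarrow> \<mu> X (\<eta> (ob PD X) u) = u"
  using monad by (auto simp: is_monad_def)

lemma right_unit: "u \<in> elts (ob PD X) \<Longrightarrow> \<mu> X (ar PD (\<eta> X) u) = u"
  using monad by (auto simp: is_monad_def)

text \<open>If one value of the unit is empty, all are, and then the right unit law cannot
  distinguish \<open>{\<delta>\<^sub>a}\<close> from \<open>{\<delta>\<^sub>b}\<close>.\<close>

lemma unit_nonempty:
  assumes "x \<in> elts X"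
  shows "elts (\<eta> X x) \<noteq> {}"
proof
  assume empty: "elts (\<eta> X x) = {}"
  define a b :: 'v where "a = vnat 0" and "b = vnat 1"
  define Y where "Y = vset {a, b}"
  have Y: "elts Y = {a, b}"
    by (simp add: Y_def elts_vset small_countable)
  have const: "\<eta> Y y = vdists {}" if "y \<in> elts Y" for y
  proof (rule extensionality)
    have "\<eta> Y y = ar PD (\<lambda>_. y) (\<eta> X x)"
      using unit_natural[of "\<lambda>_. y" X Y x] that assms by simp
    then show "elts (\<eta> Y y) = elts (vdists {})"
      by (simp add: elts_PD_ar empty elts_vdists)
  qed
  \<comment> \<open>As the unit is constant on \<open>Y\<close>, the right unit law writes
    \<open>{return_pmf y}\<close> as a value of \<open>\<mu> Y\<close> that does not depend on
    \<open>y\<close>.\<close>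
  have "vdists {return_pmf y} = \<mu> Y (vdists {return_pmf (vdists {})})" if "y \<in> elts Y" for y
  proof -
    have "vdists {return_pmf y} \<in> elts (ob PD Y)"
      using that by (intro vdists_in_PD) auto
    then show ?thesis
      using right_unit[of "vdists {return_pmf y}" Y] that by (simp add: PD_ar_vdists const)
  qed
  then have "vdists {return_pmf a} = vdists {return_pmf b}"
    unfolding Y by (metis insertI1 insertI2)
  then show False
    by (auto simp: vdists_eq_iff a_def b_def inj_eq[OF inj_vnat] simp del: vnat.simps)
qed

text \<open>A singleton carries only the Dirac distribution, so nonemptiness determines the unit
  there; naturality along its inclusion into \<open>X\<close> does the rest.\<close>

lemma unit_eq:
  assumes x: "x \<in> elts X"
  shows "\<eta> X x = vdists {return_pmf x}"
proof -
  define S where "S = vset {x}"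
  have S: "elts S = {x}"
    by (simp add: S_def elts_vset small_countable)
  have "elts (\<eta> S x) \<subseteq> {vdist (return_pmf x)}"
    using unit_closed[of x S] by (auto simp: elts_PD S set_pmf_subset_singleton)
  with unit_nonempty[of x S] have "elts (\<eta> S x) = {vdist (return_pmf x)}"
    by (auto simp: S)
  then have "elts (ar PD (\<lambda>x. x) (\<eta> S x)) = {vdist (return_pmf x)}"
    by (simp add: elts_PD_ar D_ar)
  moreover have "\<eta> X x = ar PD (\<lambda>x. x) (\<eta> S x)"
    using unit_natural[of "\<lambda>x. x" S X x] x by (simp add: S)
  ultimately show ?thesis
    by (intro extensionality) (simp add: elts_vdists)
qed

lemma mult_return:
  "u \<in> elts (ob PD X) \<Longrightarrow> \<mu> X (vdists {return_pmf u}) = u"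
  using left_unit[of u X] by (simp add: unit_eq)

lemma mult_fair_mix_return:
  assumes "x \<in> elts X" "y \<in> elts X"
  shows "\<mu> X (vdists {fair_mix (vdists {return_pmf x}) (vdists {return_pmf y})}) =
    vdists {fair_mix x y}"
proof -
  have "vdists {fair_mix x y} \<in> elts (ob PD X)"
    using assms by (intro vdists_in_PD) auto
  then show ?thesis
    using right_unit[of "vdists {fair_mix x y}" X] assms by (simp add: PD_ar_vdists unit_eq)
qed

lemma inconsistent: False
proof -
  define a b c d :: 'v where "a = vnat 0" and "b = vnat 1" and "c = vnat 2" and "d = vnat 3"
  have ne: "a \<noteq> b" "a \<noteq> c" "a \<noteq> d" "b \<noteq> c" "b \<noteq> d" "c \<noteq> d"
    by (simp_all add: a_def b_def c_def d_def inj_eq[OF inj_vnat] del: vnat.simps)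
  define X where "X = vset {a, b, c, d}"
  have X: "elts X = {a, b, c, d}"
    by (simp add: X_def elts_vset small_countable)
  define pts where "pts S = vdists (return_pmf ` S)" for S :: "'v set"
  define U where "U = vdists {fair_mix (pts {a, b}) (pts {c, d})}"
  have pts: "pts {x, y} \<in> elts (ob PD X)" if "x \<in> elts X" "y \<in> elts X" for x y
    unfolding pts_def using that by (intro vdists_in_PD) auto
  have U: "U \<in> elts (ob PD (ob PD X))"
    unfolding U_def by (intro vdists_in_PD) (auto simp: X intro!: pts)
  define W where "W = \<mu> X U"
  have W: "W \<in> elts (ob PD X)"
    unfolding W_def by (rule mult_closed[OF U])
  have push: "ar PD f W = \<mu> X (vdists {fair_mix (pts {f a, f b}) (pts {f c, f d})})"
    if "f \<in> elts X \<rightarrow> elts X" for f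
    using mult_natural[OF that U] by (simp add: W_def U_def pts_def PD_ar_vdists)
  \<comment> \<open>The three ways to merge the four points in pairs, realized as maps from
    \<open>X\<close> to itself so that \<open>push\<close> applies.\<close>
  define f g h where
    "f = (\<lambda>z. if z = a \<or> z = b then a else c)" and
    "g = (\<lambda>z. if z = a \<or> z = c then a else b)" and
    "h = (\<lambda>z. if z = a \<or> z = d then a else b)"
  have "ar PD f W = vdists {fair_mix a c}"
    using push[of f] mult_fair_mix_return[of a X c] ne by (auto simp: f_def X pts_def)
  then have f: "ar D_F f ` elts W = {vdist (fair_mix a c)}"
    by (metis elts_PD_ar elts_vdists countable_empty countable_insert image_empty image_insert)
  \<comment> \<open>Both \<open>{a, b}\<close> and \<open>{c, d}\<close> are sent onto
    \<open>{a, b}\<close>, so the mixture becomes Dirac.\<close>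
  have "ar PD g W = pts {a, b}"
    using push[of g] mult_return[OF pts, of a b] ne by (auto simp: g_def X)
  then have g: "ar D_F g ` elts W = vdist ` return_pmf ` {a, b}"
    by (metis elts_PD_ar elts_vdists pts_def countable_finite finite.intros finite_imageI)
  have "ar PD h W = pts {a, b}"
    using push[of h] mult_return[OF pts, of a b] ne by (auto simp: h_def X insert_commute)
  then have h: "ar D_F h ` elts W = vdist ` return_pmf ` {a, b}"
    by (metis elts_PD_ar elts_vdists pts_def countable_finite finite.intros finite_imageI)
  from f obtain w where w: "w \<in> elts W" by blast
  with W obtain p where p: "w = vdist p" "set_pmf p \<subseteq> elts X"
    by (auto simp: elts_PD)
  have "map_pmf f p = fair_mix a c"
    using f w by (auto simp: p(1) D_ar inj_eq[OF inj_vdist] dest!: equalityD1)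
  then have fp: "f ` set_pmf p = {a, c}"
    by (metis set_map_pmf set_fair_mix)
  have "map_pmf g p \<in> return_pmf ` {a, b}" "map_pmf h p \<in> return_pmf ` {a, b}"
    using equalityD1[OF g] equalityD1[OF h] w
    by (auto simp: p(1) D_ar inj_eq[OF inj_vdist] image_subset_iff)
  then obtain y z where gp: "g ` set_pmf p = {y}" and hp: "h ` set_pmf p = {z}"
    by (metis imageE set_map_pmf set_return_pmf)
  \<comment> \<open>One support point from each side of the split by \<open>f\<close>:
    \<open>g\<close> merges such points only as \<open>a, c\<close> or \<open>b, d\<close>, and
    \<open>h\<close> only as \<open>a, d\<close> or \<open>b, c\<close>, so no such pair is merged
    by both.\<close>
  from fp obtain s t where st: "s \<in> set_pmf p" "t \<in> set_pmf p" "f s = a" "f t = c"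
    by (metis imageE insertI1 insertI2)
  then have "g s = g t" "h s = h t"
    using gp hp by (metis imageI singletonD)+
  moreover have "s \<in> {a, b}" "t \<in> {c, d}"
    using st p(2) ne by (auto simp: f_def X split: if_splits)
  ultimately show False
    using ne by (auto simp: g_def h_def)
qed

end

theorem theorem6p4:
  "\<not> (\<exists>(\<eta> :: 'v::zfc_universe \<Rightarrow> 'v \<Rightarrow> 'v) \<mu>. is_monad (P_F \<odot> D_F) \<eta> \<mu>)"
  by (auto dest: PD_monad.intro PD_monad.inconsistent)

end
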